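(* Let $G$ be a finite tree with a proper edge coloring $\kappa:E(G)\to[k]$. If $G$ contains a symmetric edge, then $\mathfrak{G}_\kappa= S_{V(G)}$.
   Context: A proper edge coloring of $G$ on $k$ colors is a surjective map $\kappa:E(G)\to[k]$ such that edges sharing a vertex receive different colors. For $a\in[k]$, $\tau_a\in S_{V(G)}$ is the product of the transpositions $(i,j)$ over all edges $\{i,j\}$ colored $a$, and the coloring group $\mathfrak{G}_\kappa\le S_{V(G)}$ is the subgroup generated by $\tau_1,\dots,\tau_k$. An edge $e$ of $G$ is called a symmetric edge if all edges incident to $e$ (i.e. sharing an endpoint with $e$, other than $e$ itself) have pairwise distinct colors, and there exists a subset $S\subseteq[k]$ that contains the colors of all edges incident to $e$ but does not contain $\kappa(e)$, such that deleting all edges whose color lies in $S$ (keeping all vertices) leaves a graph with exactly one connected component of even order. *)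

theory Defs
  imports
    "HOL-Algebra.Bij"
    "HOL-Algebra.Generated_Groups"
    "HOL-Combinatorics.Transposition"
    "HOL-Library.Disjoint_Sets"
begin

text \<open>A graph is a pair of a vertex set \<open>V\<close> and a set \<open>E\<close> of two-element subsets of \<open>V\<close>.\<close>

definition finite_simple_graph :: "'a set \<Rightarrow> 'a set set \<Rightarrow> bool" where
  "finite_simple_graph V E \<longleftrightarrow> finite V \<and> (\<forall>e\<in>E. e \<subseteq> V \<and> card e = 2)"

definition adjacent :: "'a set set \<Rightarrow> ('a \<times> 'a) set" where
  "adjacent E = {(u, v). {u, v} \<in> E}"

text \<open>The vertex sets of the connected components; isolated vertices count.\<close>

definition components :: "'a set \<Rightarrow> 'a set set \<Rightarrow> 'a set set" where
  "components V E = V // {(u, v). u \<in> V \<and> v \<in> V \<and> (u, v) \<in> (adjacent E)\<^sup>*}"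

definition connected_graph :: "'a set \<Rightarrow> 'a set set \<Rightarrow> bool" where
  "connected_graph V E \<longleftrightarrow> V \<noteq> {} \<and> (\<forall>u\<in>V. \<forall>v\<in>V. (u, v) \<in> (adjacent E)\<^sup>*)"

text \<open>The list enumerates the vertices of the cycle once each; the closing edge joins its
  last element to its head.\<close>

definition is_cycle :: "'a set set \<Rightarrow> 'a list \<Rightarrow> bool" where
  "is_cycle E p \<longleftrightarrow> 3 \<le> length p \<and> distinct p \<and>
     (\<forall>i. Suc i < length p \<longrightarrow> {p ! i, p ! Suc i} \<in> E) \<and> {last p, hd p} \<in> E"

definition finite_tree :: "'a set \<Rightarrow> 'a set set \<Rightarrow> bool" where
  "finite_tree V E \<longleftrightarrow>
     finite_simple_graph V E \<and> connected_graph V E \<and> \<not> (\<exists>p. is_cycle E p)"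

definition proper_edge_coloring :: "'a set set \<Rightarrow> nat \<Rightarrow> ('a set \<Rightarrow> nat) \<Rightarrow> bool" where
  "proper_edge_coloring E k \<kappa> \<longleftrightarrow> \<kappa> ` E = {1..k} \<and>
     (\<forall>e\<in>E. \<forall>f\<in>E. e \<noteq> f \<and> e \<inter> f \<noteq> {} \<longrightarrow> \<kappa> e \<noteq> \<kappa> f)"

definition incident_edges :: "'a set set \<Rightarrow> 'a set \<Rightarrow> 'a set set" where
  "incident_edges E e = {f \<in> E. f \<noteq> e \<and> f \<inter> e \<noteq> {}}"

definition symmetric_edge ::
    "'a set \<Rightarrow> 'a set set \<Rightarrow> nat \<Rightarrow> ('a set \<Rightarrow> nat) \<Rightarrow> 'a set \<Rightarrow> bool" where
  "symmetric_edge V E k \<kappa> e \<longleftrightarrow> e \<in> E \<and> inj_on \<kappa> (incident_edges E e) \<and>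
     (\<exists>S \<subseteq> {1..k}. \<kappa> ` incident_edges E e \<subseteq> S \<and> \<kappa> e \<notin> S \<and>
        card {C \<in> components V {f \<in> E. \<kappa> f \<notin> S}. even (card C)} = 1)"

text \<open>The transposition \<open>(i, j)\<close> of an edge \<open>{i, j}\<close>, unique since
  \<open>transpose i j = transpose j i\<close>.\<close>

definition edge_transposition :: "'a set \<Rightarrow> 'a \<Rightarrow> 'a" where
  "edge_transposition e = (THE t. \<exists>i j. e = {i, j} \<and> t = transpose i j)"

text \<open>The order of the factors is immaterial: under a proper coloring, edges of equal color
  are disjoint, so their transpositions commute and the \<open>fold\<close> is well defined
  (see \<open>color_perm_apply\<close> below).\<close>

definition color_perm :: "'a set set \<Rightarrow> ('a set \<Rightarrow> nat) \<Rightarrow> nat \<Rightarrow> 'a \<Rightarrow> 'a" where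
  "color_perm E \<kappa> a =
     Finite_Set.fold (\<lambda>e p. edge_transposition e \<circ> p) id {e \<in> E. \<kappa> e = a}"

text \<open>The elements of \<open>BijGroup V\<close>, the symmetric group on \<open>V\<close>, are functions that are
  undefined outside \<open>V\<close>, hence the restriction.\<close>

definition coloring_group :: "'a set \<Rightarrow> 'a set set \<Rightarrow> nat \<Rightarrow> ('a set \<Rightarrow> nat) \<Rightarrow> ('a \<Rightarrow> 'a) set" where
  "coloring_group V E k \<kappa> =
     generate (BijGroup V) ((\<lambda>a. restrict (color_perm E \<kappa> a) V) ` {1..k})"

lemma edge_transposition_pair [simp]: "edge_transposition {i, j} = transpose i j"
  unfolding edge_transposition_def
  by (rule the_equality) (auto simp: doubleton_eq_iff transpose_commute)

lemma fold_edge_transposition: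
  assumes "finite M" "\<And>e. e \<in> M \<Longrightarrow> card e = 2" "disjoint M"
  shows "{i, j} \<in> M \<Longrightarrow> Finite_Set.fold (\<lambda>e p. edge_transposition e \<circ> p) id M i = j"
    and "x \<notin> \<Union>M \<Longrightarrow> Finite_Set.fold (\<lambda>e p. edge_transposition e \<circ> p) id M x = x"
proof -
  let ?f = "\<lambda>e p. edge_transposition e \<circ> p :: 'a \<Rightarrow> 'a"
  have comm: "comp_fun_commute_on M ?f"
  proof
    fix e f assume ef: "e \<in> M" "f \<in> M"
    obtain i j k l where eq: "e = {i, j}" "f = {k, l}"
      using assms(2) ef by (meson card_2_iff)
    have "e = f \<or> e \<inter> f = {}"
      using assms(3) ef unfolding disjoint_def by blast
    hence "edge_transposition f \<circ> edge_transposition e =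
        edge_transposition e \<circ> edge_transposition f"
    proof
      assume "e \<inter> f = {}"
      hence "i \<noteq> k" "i \<noteq> l" "j \<noteq> k" "j \<noteq> l" using eq by auto
      thus ?thesis unfolding eq edge_transposition_pair
        by (simp add: fun_eq_iff transpose_def)
    qed simp
    thus "?f f \<circ> ?f e = ?f e \<circ> ?f f"
      by (simp add: fun_eq_iff)
  qed
  interpret comp_fun_commute_on M ?f by (fact comm)
  have main: "(\<forall>i j. {i, j} \<in> N \<longrightarrow> Finite_Set.fold ?f id N i = j) \<and>
      (\<forall>x. x \<notin> \<Union>N \<longrightarrow> Finite_Set.fold ?f id N x = x)" if "N \<subseteq> M" for N
    using finite_subset[OF that assms(1)] that
  proof (induction N rule: finite_induct)
    case empty
    then show ?case by simp
  next
    case (insert e N)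
    have eM: "e \<in> M" and NM: "N \<subseteq> M" using insert.prems by auto
    obtain k l where e: "e = {k, l}"
      using assms(2) eM by (meson card_2_iff)
    have disj: "e \<inter> f = {}" if "f \<in> N" for f
    proof -
      have "f \<in> M" "e \<noteq> f" using that NM insert.hyps(2) by auto
      thus ?thesis using assms(3) eM unfolding disjoint_def by simp
    qed
    have fold: "Finite_Set.fold ?f id (insert e N) = transpose k l \<circ> Finite_Set.fold ?f id N"
      unfolding fold_insert[OF insert.prems insert.hyps] unfolding e edge_transposition_pair ..
    note IH = insert.IH[OF NM]
    show ?case
    proof (intro conjI allI impI)
      fix i j assume ij: "{i, j} \<in> insert e N"
      show "Finite_Set.fold ?f id (insert e N) i = j"
      proof (cases "{i, j} = e")
        case True
        hence "i \<notin> \<Union>N" using disj by blast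
        hence "Finite_Set.fold ?f id N i = i" using IH by blast
        moreover have "transpose k l i = j"
          using True unfolding e doubleton_eq_iff by auto
        ultimately show ?thesis unfolding fold by simp
      next
        case False
        hence N: "{i, j} \<in> N" using ij by blast
        hence "j \<noteq> k" "j \<noteq> l" using disj[OF N] e by auto
        moreover have "Finite_Set.fold ?f id N i = j" using IH N by blast
        ultimately show ?thesis unfolding fold by simp
      qed
    next
      fix x assume "x \<notin> \<Union>(insert e N)"
      hence "x \<notin> e" "x \<notin> \<Union>N" by auto
      hence "x \<noteq> k" "x \<noteq> l" "Finite_Set.fold ?f id N x = x" using IH e by blast+
      thus "Finite_Set.fold ?f id (insert e N) x = x"
        unfolding fold by simp
    qed
  qed
  show "{i, j} \<in> M \<Longrightarrow> Finite_Set.fold ?f id M i = j"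
    and "x \<notin> \<Union>M \<Longrightarrow> Finite_Set.fold ?f id M x = x"
    using main[of M] by blast+
qed

lemma color_perm_apply:
  assumes "finite_simple_graph V E" "proper_edge_coloring E k \<kappa>"
  shows "{i, j} \<in> E \<Longrightarrow> \<kappa> {i, j} = a \<Longrightarrow> color_perm E \<kappa> a i = j"
    and "(\<And>e. e \<in> E \<Longrightarrow> \<kappa> e = a \<Longrightarrow> x \<notin> e) \<Longrightarrow> color_perm E \<kappa> a x = x"
proof -
  let ?M = "{e \<in> E. \<kappa> e = a}"
  have "finite E"
    using assms(1) unfolding finite_simple_graph_def
    by (meson Pow_iff finite_Pow_iff finite_subset subsetI)
  hence M: "finite ?M" "\<And>e. e \<in> ?M \<Longrightarrow> card e = 2"
    using assms(1) unfolding finite_simple_graph_def by auto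
  have "disjoint ?M"
    using assms(2) unfolding proper_edge_coloring_def disjoint_def
    by (metis (mono_tags, lifting) mem_Collect_eq)
  note M = M this
  show "{i, j} \<in> E \<Longrightarrow> \<kappa> {i, j} = a \<Longrightarrow> color_perm E \<kappa> a i = j"
    unfolding color_perm_def by (rule fold_edge_transposition(1)[OF M]) auto
  show "(\<And>e. e \<in> E \<Longrightarrow> \<kappa> e = a \<Longrightarrow> x \<notin> e) \<Longrightarrow> color_perm E \<kappa> a x = x"
    unfolding color_perm_def by (rule fold_edge_transposition(2)[OF M]) auto
qed

lemma color_perm_in_BijGroup:
  assumes "finite_simple_graph V E" "proper_edge_coloring E k \<kappa>"
  shows "restrict (color_perm E \<kappa> a) V \<in> carrier (BijGroup V)"
proof -
  let ?t = "color_perm E \<kappa> a"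
  have inv: "?t x \<in> V \<and> ?t (?t x) = x" if "x \<in> V" for x
  proof (cases "\<exists>e\<in>E. \<kappa> e = a \<and> x \<in> e")
    case True
    then obtain e where e: "e \<in> E" "\<kappa> e = a" "x \<in> e" by blast
    then obtain y where y: "e = {x, y}"
      using assms(1) unfolding finite_simple_graph_def
      by (metis card_2_iff insert_commute insert_iff singletonD)
    have "?t x = y" "?t y = x"
      using color_perm_apply(1)[OF assms] e y by (auto simp: insert_commute)
    moreover have "y \<in> V"
      using assms(1) e y unfolding finite_simple_graph_def by auto
    ultimately show ?thesis by simp
  next
    case False
    thus ?thesis using color_perm_apply(2)[OF assms, of a x] that by auto
  qed
  have "bij_betw ?t V V"
    by (rule bij_betw_byWitness[where f' = ?t]) (use inv in auto)
  thus ?thesis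
    by (simp add: BijGroup_def Bij_def bij_betw_restrict_eq)
qed

end

theory Submission
  imports Defs "HOL-Combinatorics.Orbits"
begin

text \<open>Multiplying a permutation by a transposition that meets two of its cycles merges them. Hence,
  in a forest, a product of the edge transpositions, in any order, acts on each component as one
  long cycle. Take the \<open>\<tau>\<^sub>a\<close> with \<open>a \<notin> S\<close>: their product swaps the ends \<open>u\<close>, \<open>v\<close> of the symmetric
  edge, since \<open>{u, v}\<close> is the component of even order, and all its other cycles are odd, so an odd
  power of it is the transposition \<open>(u v)\<close>. The relation \<open>(x y) \<in> \<GG>\<close> is an equivalence relation
  invariant under the coloring group. Since each \<open>\<tau>\<^sub>a\<close> fixes \<open>u\<close>, fixes \<open>v\<close>, or swaps them, it
  maps the class of \<open>u\<close> to itself, so by connectedness this class is all of \<open>V\<close>.\<close>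

section \<open>Paths and cycles\<close>

lemma adjacent_rtrancl_mono: "F \<subseteq> F' \<Longrightarrow> (adjacent F)\<^sup>* \<subseteq> (adjacent F')\<^sup>*"
  by (rule rtrancl_mono) (auto simp: adjacent_def)

text \<open>Induction along the walk: a new endpoint already on the path is not appended; the path
  is cut off there, which keeps its vertices distinct.\<close>

lemma adjacent_rtrancl_imp_path:
  assumes "(x, y) \<in> (adjacent F)\<^sup>*"
  obtains p where "p \<noteq> []" "distinct p" "hd p = x" "last p = y"
    "successively (\<lambda>a b. {a, b} \<in> F) p"
proof -
  from assms have "\<exists>p. p \<noteq> [] \<and> distinct p \<and> hd p = x \<and> last p = y
    \<and> successively (\<lambda>a b. {a, b} \<in> F) p"
  proof (induction rule: rtrancl_induct)
    case base
    show ?case by (rule exI[of _ "[x]"]) simp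
  next
    case (step y z)
    then obtain p where p: "p \<noteq> []" "distinct p" "hd p = x" "last p = y"
      "successively (\<lambda>a b. {a, b} \<in> F) p" by blast
    show ?case
    proof (cases "z \<in> set p")
      case True
      then obtain q r where "p = (q @ [z]) @ r"
        using split_list[of z p] by auto
      then have "distinct (q @ [z])" "hd (q @ [z]) = x"
        "successively (\<lambda>a b. {a, b} \<in> F) (q @ [z])"
        using p by (auto simp: successively_append_iff hd_append)
      then show ?thesis by (intro exI[of _ "q @ [z]"]) simp
    next
      case False
      have "{y, z} \<in> F" using step.hyps(2) by (simp add: adjacent_def)
      then have "successively (\<lambda>a b. {a, b} \<in> F) (p @ [z])"
        using p by (simp add: successively_append_iff)
      then show ?thesis using p False by (intro exI[of _ "p @ [z]"]) simp
    qed
  qed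
  then show thesis using that by blast
qed

text \<open>A simple path in \<open>F\<close> between the ends of an edge outside \<open>F\<close>
  closes up to a cycle: \<open>i \<noteq> j\<close> rules out length 1 and
  \<open>{i, j} \<notin> F\<close> length 2. In a forest, the ends of a new edge therefore lie in
  different components of \<open>F\<close>.\<close>

lemma is_cycle_closing_path:
  assumes "(i, j) \<in> (adjacent F)\<^sup>*" "i \<noteq> j" "{i, j} \<notin> F" "{i, j} \<in> E" "F \<subseteq> E"
  shows "\<exists>p. is_cycle E p"
proof -
  obtain p where p: "p \<noteq> []" "distinct p" "hd p = i" "last p = j"
    "successively (\<lambda>a b. {a, b} \<in> F) p"
    using adjacent_rtrancl_imp_path[OF assms(1)] .
  have "length p \<noteq> 1" using p assms(2) by (auto simp: length_Suc_conv)
  moreover have "length p \<noteq> 2"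
    using p assms(3) by (auto simp: length_Suc_conv numeral_2_eq_2)
  ultimately have "3 \<le> length p" using p(1) by (cases "length p") auto
  moreover have "{p ! n, p ! Suc n} \<in> E" if "Suc n < length p" for n
    using p(5) that assms(5) by (auto simp: successively_conv_nth)
  moreover have "{last p, hd p} \<in> E" using p assms(4) by (simp add: insert_commute)
  ultimately show ?thesis unfolding is_cycle_def using p(2) by blast
qed

section \<open>Products of edge transpositions\<close>

lemma permutation_orbit_sym:
  assumes "permutation f" "y \<in> orbit f x"
  shows "x \<in> orbit f y"
  by (rule orbit_swap[OF permutation_self_in_orbit[OF assms(1)] assms(2)])

text \<open>Starting from \<open>j\<close>, \<open>transpose i j \<circ> f\<close> runs through the
  cycle of \<open>f\<close> unchanged, because this cycle avoids \<open>i\<close> and returns to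
  \<open>j\<close> only at its end. The predecessor of \<open>j\<close> is then sent to
  \<open>i\<close>, which lies on the other cycle.\<close>

lemma orbit_transpose_comp:
  assumes "permutation f" "i \<notin> orbit f j"
  shows "orbit f j \<subseteq> orbit (transpose i j \<circ> f) j"
    and "i \<in> orbit (transpose i j \<circ> f) j"
proof -
  let ?g = "transpose i j \<circ> f"
  have g: "permutation ?g"
    by (rule permutation_compose[OF permutation_swap_id assms(1)])
  have self: "j \<in> orbit ?g j" by (rule permutation_self_in_orbit[OF g])
  have image: "f y \<in> orbit ?g j" if "y \<in> orbit f j" "y \<in> orbit ?g j" for y
  proof (cases "f y = j")
    case False
    moreover have "f y \<noteq> i" using assms(2) orbit.step[OF that(1)] by blast
    ultimately have "?g y = f y" by simp
    then show ?thesis using orbit.step[OF that(2)] by simp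
  qed (use self in simp)
  show sub: "orbit f j \<subseteq> orbit ?g j"
  proof
    fix y assume "y \<in> orbit f j"
    then show "y \<in> orbit ?g j"
    proof induction
      case base
      show ?case by (rule image[OF permutation_self_in_orbit[OF assms(1)] self])
    next
      case (step y)
      then show ?case by (intro image)
    qed
  qed
  have "j \<in> orbit f j" by (rule permutation_self_in_orbit[OF assms(1)])
  then obtain y where y: "y \<in> orbit f j" "f y = j"
    by (metis orbit.cases permutation_self_in_orbit[OF assms(1)])
  then have "?g y \<in> orbit ?g j" using orbit.step[of y ?g j] sub by blast
  then show "i \<in> orbit ?g j" using y by simp
qed

text \<open>The equation ranges over the whole type, so a point on no edge of \<open>F\<close> is
  its own component and \<open>f\<close> fixes it.\<close>

definition spans :: "('a \<Rightarrow> 'a) \<Rightarrow> 'a set set \<Rightarrow> bool" where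
  "spans f F \<longleftrightarrow> permutation f \<and> (\<forall>x. orbit f x = (adjacent F)\<^sup>* `` {x})"

text \<open>The new edge merges two components just as the transposition merges two cycles of
  \<open>f\<close>; all other cycles and components stay as they are.\<close>

lemma spans_transpose:
  assumes "spans f F" "(i, j) \<notin> (adjacent F)\<^sup>*"
  shows "spans (transpose i j \<circ> f) (insert {i, j} F)"
proof -
  let ?g = "transpose i j \<circ> f" and ?F = "insert {i, j} F"
  have f: "permutation f" and orb: "orbit f x = (adjacent F)\<^sup>* `` {x}" for x
    using assms(1) by (auto simp: spans_def)
  have g: "permutation ?g"
    by (rule permutation_compose[OF permutation_swap_id f])
  note self = permutation_self_in_orbit[OF g] and sym = permutation_orbit_sym[OF g]
  have ji: "j \<notin> orbit f i" using assms(2) orb by blast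
  have ij: "i \<notin> orbit f j" using ji permutation_orbit_sym[OF f] by blast
  note J = orbit_transpose_comp[OF f ij]
  \<comment> \<open>The situation is symmetric in \<open>i\<close> and \<open>j\<close>.\<close>
  note I = orbit_transpose_comp[OF f ji, unfolded transpose_commute[of j i]]
  \<comment> \<open>If \<open>f x\<close> is \<open>i\<close> or \<open>j\<close>, then
    \<open>x\<close> lies on the \<open>f\<close>-cycle of that end, and \<open>I\<close> or
    \<open>J\<close> puts this whole cycle into one orbit of \<open>?g\<close>.\<close>
  have fx: "f x \<in> orbit ?g x" for x
  proof -
    have x: "x \<in> orbit f (f x)"
      using permutation_orbit_sym[OF f orbit.base] .
    consider "f x = i" | "f x = j" | "?g x = f x" by (metis comp_apply transpose_apply_other)
    then show ?thesis
    proof cases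
      case 1
      then show ?thesis using x I(1) sym by auto
    next
      case 2
      then show ?thesis using x J(1) sym by auto
    next
      case 3
      then show ?thesis using orbit.base[of ?g x] by simp
    qed
  qed
  have sub: "y \<in> orbit ?g x" if "y \<in> orbit f x" for x y
    using that
  proof induction
    case (step y)
    then show ?case using orbit_trans[OF fx] by blast
  qed (rule fx)
  have adj: "y \<in> orbit ?g x" if "(x, y) \<in> adjacent ?F" for x y
  proof (cases "{x, y} \<in> F")
    case True
    then have "y \<in> orbit f x" unfolding orb by (auto simp: adjacent_def)
    then show ?thesis by (rule sub)
  next
    case False
    then show ?thesis
      using that I(2) J(2) by (auto simp: adjacent_def doubleton_eq_iff)
  qed
  \<comment> \<open>For the converse inclusion: a step of \<open>?g\<close> is a step of
    \<open>f\<close>, inside a component of \<open>F\<close>, followed at most by a move along the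
    new edge.\<close>
  have gx: "(x, ?g x) \<in> (adjacent ?F)\<^sup>*" for x
  proof -
    have "f x \<in> orbit f x" by (rule orbit.base)
    then have "(x, f x) \<in> (adjacent ?F)\<^sup>*"
      unfolding orb using adjacent_rtrancl_mono[of F ?F] by blast
    moreover have "(f x, ?g x) \<in> (adjacent ?F)\<^sup>*"
      by (auto simp: transpose_def adjacent_def insert_commute)
    ultimately show ?thesis by (rule rtrancl_trans)
  qed
  have "orbit ?g x = (adjacent ?F)\<^sup>* `` {x}" for x
  proof (intro equalityI subsetI)
    fix y assume "y \<in> orbit ?g x"
    then have "(x, y) \<in> (adjacent ?F)\<^sup>*"
    proof induction
      case (step y)
      then show ?case using rtrancl_trans[OF _ gx] by blast
    qed (rule gx)
    then show "y \<in> (adjacent ?F)\<^sup>* `` {x}" by simp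
  next
    fix y assume "y \<in> (adjacent ?F)\<^sup>* `` {x}"
    then have "(x, y) \<in> (adjacent ?F)\<^sup>*" by simp
    then show "y \<in> orbit ?g x"
    proof induction
      case (step y z)
      then show ?case using orbit_trans[OF adj] by blast
    qed (rule self)
  qed
  with g show ?thesis by (simp add: spans_def)
qed

text \<open>Both sides are compared pointwise through the known values of the two folds, so that the
  commutation of the factors is not argued again.\<close>

lemma fold_edge_transposition_insert:
  assumes "finite M" "\<And>e. e \<in> insert {i, j} M \<Longrightarrow> card e = 2" "disjoint (insert {i, j} M)"
    and "{i, j} \<notin> M"
  shows "Finite_Set.fold (\<lambda>e p. edge_transposition e \<circ> p) id (insert {i, j} M) =
    transpose i j \<circ> Finite_Set.fold (\<lambda>e p. edge_transposition e \<circ> p) id M"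
proof
  fix x
  let ?fold = "Finite_Set.fold (\<lambda>e p. edge_transposition e \<circ> p) id"
  have disj: "{i, j} \<inter> f = {}" if "f \<in> M" for f
    using assms(3,4) that unfolding disjoint_def by (metis insert_iff)
  have dM: "disjoint M" using assms(3) by (meson disjoint_def insert_iff)
  note ins = fold_edge_transposition[OF finite.insertI[OF assms(1)] assms(2,3)]
  note old = fold_edge_transposition[OF assms(1) assms(2) dM]
  consider "x = i" | "x = j" | f where "f \<in> M" "x \<in> f" | "x \<notin> \<Union>(insert {i, j} M)" by auto
  then show "?fold (insert {i, j} M) x = (transpose i j \<circ> ?fold M) x"
  proof cases
    case 1
    then have "x \<notin> \<Union>M" using disj by blast
    then show ?thesis using 1 ins(1)[of i j] old(2)[of x] by simp
  next
    case 2
    then have "x \<notin> \<Union>M" using disj by blast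
    then show ?thesis using 2 ins(1)[of j i] old(2)[of x] by (simp add: insert_commute)
  next
    case (3 f)
    then obtain y where y: "f = {x, y}"
      using assms(2) by (metis card_2_iff insert_commute insert_iff singletonD)
    then have "y \<noteq> i" "y \<noteq> j" using disj[OF 3(1)] by auto
    then show ?thesis using 3 y ins(1)[of x y] old(1)[of x y] by simp
  next
    case 4
    then show ?thesis using ins(2)[of x] old(2)[of x] by simp
  qed
qed

text \<open>\<open>M\<close> stands for a color class and \<open>F\<close> for the edges of the
  colors already multiplied in. The edges of \<open>M\<close> are added one by one; by acyclicity
  each of them joins two different components, so \<open>spans_transpose\<close> applies.\<close>

lemma spans_fold_edge_transposition:
  assumes acyclic: "\<not> (\<exists>p. is_cycle E p)" and card: "\<And>e. e \<in> E \<Longrightarrow> card e = 2"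
    and "spans f F" "F \<subseteq> E"
    and "finite M" "M \<subseteq> E" "disjoint M" "F \<inter> M = {}"
  shows "spans (Finite_Set.fold (\<lambda>e p. edge_transposition e \<circ> p) id M \<circ> f) (F \<union> M)"
  using assms(5-8)
proof (induction M rule: finite_induct)
  case empty
  then show ?case using assms(3) by simp
next
  case (insert e M)
  let ?fold = "Finite_Set.fold (\<lambda>e p. edge_transposition e \<circ> p) id"
  have "disjoint M" using insert.prems(2) by (meson disjoint_def insert_iff)
  then have IH: "spans (?fold M \<circ> f) (F \<union> M)"
    using insert.prems by (intro insert.IH) auto
  obtain i j where e: "e = {i, j}" and ij: "i \<noteq> j"
    using card[of e] insert.prems(1) by (auto simp: card_2_iff)
  have "{i, j} \<notin> F \<union> M" using insert e by auto
  then have "(i, j) \<notin> (adjacent (F \<union> M))\<^sup>*"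
    using is_cycle_closing_path[of i j "F \<union> M" E] acyclic ij assms(4) insert.prems(1) e by auto
  from spans_transpose[OF IH this]
  have "spans (transpose i j \<circ> ?fold M \<circ> f) (F \<union> insert e M)" by (simp only: e comp_assoc Un_insert_right)
  moreover have "?fold (insert e M) = transpose i j \<circ> ?fold M"
    unfolding e by (rule fold_edge_transposition_insert)
      (use insert card e in auto)
  ultimately show ?case by (simp only:)
qed

section \<open>Return times of points\<close>

lemma spans_funpow_card:
  assumes "spans f F"
  shows "(f ^^ card ((adjacent F)\<^sup>* `` {x})) x = x"
proof -
  have "x \<in> orbit f x" using assms permutation_self_in_orbit by (auto simp: spans_def)
  \<comment> \<open>The least positive return time \<open>funpow_dist1 f x x\<close> enumerates the
    orbit without repetition, so it is the size of the orbit.\<close>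
  note orb = orbit_conv_funpow_dist1[OF this] inj_on_funpow_dist1[OF this]
    funpow_dist1_prop[OF this]
  have "card (orbit f x) = funpow_dist1 f x x"
    using orb(1,2) by (metis card_atLeastLessThan card_image diff_zero)
  then show ?thesis using orb(3) assms by (simp add: spans_def)
qed

lemma funpow_dvd_fixpoint:
  assumes "(f ^^ m) x = x" "m dvd n"
  shows "(f ^^ n) x = x"
proof -
  obtain q where "n = m * q" using assms(2) ..
  moreover have "((f ^^ m) ^^ q) x = x" by (induction q) (simp_all add: assms(1))
  ultimately show ?thesis by (simp add: funpow_mult)
qed

section \<open>The coloring group\<close>

text \<open>Total permutations compose without restriction, unlike the elements of \<open>BijGroup V\<close>.\<close>

definition coloring_perms :: "'a set \<Rightarrow> 'a set set \<Rightarrow> nat \<Rightarrow> ('a set \<Rightarrow> nat) \<Rightarrow> ('a \<Rightarrow> 'a) set" where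
  "coloring_perms V E k \<kappa> = {f. f permutes V \<and> restrict f V \<in> coloring_group V E k \<kappa>}"

context
  fixes V :: "'a set" and E :: "'a set set" and k :: nat and \<kappa> :: "'a set \<Rightarrow> nat"
  assumes graph: "finite_simple_graph V E" and coloring: "proper_edge_coloring E k \<kappa>"
begin

section \<open>Closure properties of the coloring group\<close>

lemma finite_edges: "finite E"
  using graph unfolding finite_simple_graph_def by (meson Pow_iff finite_Pow_iff finite_subset subsetI)

lemma color_perm_permutes: "color_perm E \<kappa> a permutes V"
proof (rule bij_imp_permutes)
  show "bij_betw (color_perm E \<kappa> a) V V"
    using color_perm_in_BijGroup[OF graph coloring, of a]
    by (simp add: BijGroup_def Bij_def bij_betw_restrict_eq)
  show "color_perm E \<kappa> a x = x" if "x \<notin> V" for x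
    using color_perm_apply(2)[OF graph coloring] that graph
    unfolding finite_simple_graph_def by blast
qed

lemma restrict_permutes_in_BijGroup: "f permutes V \<Longrightarrow> restrict f V \<in> carrier (BijGroup V)"
  by (simp add: BijGroup_def Bij_def bij_betw_restrict_eq permutes_imp_bij)

lemma id_in_coloring_perms: "id \<in> coloring_perms V E k \<kappa>"
proof -
  have "restrict id V = \<one>\<^bsub>BijGroup V\<^esub>" by (auto simp: BijGroup_def)
  then show ?thesis
    by (simp add: coloring_perms_def coloring_group_def permutes_id generate.one)
qed

lemma comp_in_coloring_perms:
  assumes "f \<in> coloring_perms V E k \<kappa>" "g \<in> coloring_perms V E k \<kappa>"
  shows "f \<circ> g \<in> coloring_perms V E k \<kappa>"
proof -
  have fg: "f permutes V" "g permutes V" using assms by (auto simp: coloring_perms_def)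
  have "restrict (f \<circ> g) V = restrict f V \<otimes>\<^bsub>BijGroup V\<^esub> restrict g V"
    using restrict_permutes_in_BijGroup[OF fg(1)] restrict_permutes_in_BijGroup[OF fg(2)]
      permutes_in_image[OF fg(2)]
    by (auto simp: BijGroup_def compose_def)
  then show ?thesis
    using assms permutes_compose[OF fg(2,1)]
    by (simp add: coloring_perms_def coloring_group_def generate.eng)
qed

lemma funpow_in_coloring_perms:
  "f \<in> coloring_perms V E k \<kappa> \<Longrightarrow> f ^^ n \<in> coloring_perms V E k \<kappa>"
  by (induction n) (simp_all add: id_in_coloring_perms comp_in_coloring_perms)

lemma color_perm_in_coloring_perms:
  "a \<in> {1..k} \<Longrightarrow> color_perm E \<kappa> a \<in> coloring_perms V E k \<kappa>"
  unfolding coloring_perms_def coloring_group_def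
  by (auto intro: color_perm_permutes generate.incl)

lemma color_perm_involution: "color_perm E \<kappa> a \<circ> color_perm E \<kappa> a = id"
proof
  fix x
  show "(color_perm E \<kappa> a \<circ> color_perm E \<kappa> a) x = id x"
  proof (cases "\<exists>e\<in>E. \<kappa> e = a \<and> x \<in> e")
    case True
    then obtain e where e: "e \<in> E" "\<kappa> e = a" "x \<in> e" by blast
    then obtain y where y: "e = {x, y}"
      using graph unfolding finite_simple_graph_def
      by (metis card_2_iff insert_commute insert_iff singletonD)
    then show ?thesis
      using color_perm_apply(1)[OF graph coloring] e by (auto simp: insert_commute)
  next
    case False
    then show ?thesis using color_perm_apply(2)[OF graph coloring, of a x] by auto
  qed
qed

text \<open>Conjugation by \<open>color_perm E \<kappa> a\<close>, which is its own inverse.\<close>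

lemma transpose_color_perm_in_coloring_perms:
  assumes "a \<in> {1..k}" "transpose x y \<in> coloring_perms V E k \<kappa>"
  shows "transpose (color_perm E \<kappa> a x) (color_perm E \<kappa> a y) \<in> coloring_perms V E k \<kappa>"
proof -
  let ?t = "color_perm E \<kappa> a"
  have "bij ?t" using color_perm_permutes permutes_bij by blast
  then have "transpose (?t x) (?t y) = transpose (?t x) (?t y) \<circ> (?t \<circ> ?t)"
    by (simp add: color_perm_involution)
  also have "\<dots> = ?t \<circ> transpose x y \<circ> ?t"
    using \<open>bij ?t\<close> by (auto simp: fun_eq_iff transpose_def bij_def inj_eq)
  finally show ?thesis
    using assms color_perm_in_coloring_perms comp_in_coloring_perms by metis
qed

text \<open>For distinct points, conjugating \<open>(y z)\<close> by \<open>(x y)\<close> gives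
  \<open>(x z)\<close>. The formula can fail if \<open>y = z\<close> or \<open>x = z\<close>, hence
  the case split.\<close>

lemma transpose_trans_in_coloring_perms:
  assumes "transpose x y \<in> coloring_perms V E k \<kappa>" "transpose y z \<in> coloring_perms V E k \<kappa>"
  shows "transpose x z \<in> coloring_perms V E k \<kappa>"
proof (cases "x = y \<or> y = z \<or> x = z")
  case True
  then show ?thesis
    using assms id_in_coloring_perms by auto
next
  case False
  then have "transpose x z = transpose x y \<circ> transpose y z \<circ> transpose x y"
    by (auto simp: fun_eq_iff transpose_def)
  then show ?thesis using assms comp_in_coloring_perms by metis
qed

section \<open>The transposition of the symmetric edge\<close>

lemma spans_color_product:
  assumes "\<not> (\<exists>p. is_cycle E p)" "finite T" "T \<subseteq> {1..k}"
  shows "\<exists>f\<in>coloring_perms V E k \<kappa>. spans f {e \<in> E. \<kappa> e \<in> T}"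
  using assms(2,3)
proof (induction T rule: finite_induct)
  case empty
  have "spans id ({} :: 'a set set)"
    by (auto simp: spans_def adjacent_def orbit_eq_singleton_iff)
  then show ?case using id_in_coloring_perms by auto
next
  case (insert a T)
  then obtain f where f: "f \<in> coloring_perms V E k \<kappa>" "spans f {e \<in> E. \<kappa> e \<in> T}" by auto
  have card: "card e = 2" if "e \<in> E" for e
    using graph that by (auto simp: finite_simple_graph_def)
  have "disjoint {e \<in> E. \<kappa> e = a}"
    using coloring unfolding proper_edge_coloring_def disjoint_def
    by (metis (mono_tags, lifting) mem_Collect_eq)
  \<comment> \<open>The color class of \<open>a\<close> is disjoint from the edges treated before
    because \<open>a \<notin> T\<close>.\<close>
  then have "spans (color_perm E \<kappa> a \<circ> f) ({e \<in> E. \<kappa> e \<in> T} \<union> {e \<in> E. \<kappa> e = a})"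
    unfolding color_perm_def
    using insert.hyps finite_edges
    by (intro spans_fold_edge_transposition[OF assms(1) card f(2)]) auto
  moreover have "{e \<in> E. \<kappa> e \<in> T} \<union> {e \<in> E. \<kappa> e = a} = {e \<in> E. \<kappa> e \<in> insert a T}" by auto
  moreover have "color_perm E \<kappa> a \<circ> f \<in> coloring_perms V E k \<kappa>"
    using f(1) insert.prems by (intro comp_in_coloring_perms color_perm_in_coloring_perms) auto
  ultimately show ?case by auto
qed

text \<open>\<open>components\<close> is a quotient by a relation restricted to \<open>V\<close>,
  whereas \<open>spans\<close> speaks of the unrestricted closure. The classes agree because edges
  do not leave \<open>V\<close>.\<close>

lemma component_of:
  assumes "x \<in> V" "F \<subseteq> E"
  shows "(adjacent F)\<^sup>* `` {x} \<in> components V F" "(adjacent F)\<^sup>* `` {x} \<subseteq> V"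
proof -
  have "y \<in> V" if "(x, y) \<in> (adjacent F)\<^sup>*" for y
    using that
  proof induction
    case (step y z)
    then show ?case
      using graph assms(2) unfolding adjacent_def finite_simple_graph_def by blast
  qed (use assms in simp)
  then show "(adjacent F)\<^sup>* `` {x} \<subseteq> V" by blast
  then have "(adjacent F)\<^sup>* `` {x} = {(u, v). u \<in> V \<and> v \<in> V \<and> (u, v) \<in> (adjacent F)\<^sup>*} `` {x}"
    using assms(1) by auto
  then show "(adjacent F)\<^sup>* `` {x} \<in> components V F"
    unfolding components_def using assms(1) by (simp only: quotientI)
qed

lemma symmetric_edge_transpose_in_coloring_perms:
  assumes acyclic: "\<not> (\<exists>p. is_cycle E p)" and symm: "symmetric_edge V E k \<kappa> {u, v}"
  shows "transpose u v \<in> coloring_perms V E k \<kappa>"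
proof -
  have uv: "{u, v} \<in> E" using symm by (simp add: symmetric_edge_def)
  then have ne: "u \<noteq> v" and V: "u \<in> V" "v \<in> V"
    using graph by (auto simp: finite_simple_graph_def)
  obtain S where S: "\<kappa> ` incident_edges E {u, v} \<subseteq> S" "\<kappa> {u, v} \<notin> S"
    and card1: "card {C \<in> components V {f \<in> E. \<kappa> f \<notin> S}. even (card C)} = 1"
    using symm unfolding symmetric_edge_def by blast
  define F where "F = {f \<in> E. \<kappa> f \<notin> S}"
  have FE: "F \<subseteq> E" by (auto simp: F_def)
  have "F = {f \<in> E. \<kappa> f \<in> {1..k} - S}"
    using coloring by (auto simp: F_def proper_edge_coloring_def)
  then obtain f where f: "f \<in> coloring_perms V E k \<kappa>" "spans f F"
    using spans_color_product[OF acyclic, of "{1..k} - S"] by auto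
  have fV: "f permutes V" using f(1) by (simp add: coloring_perms_def)
  have orb: "orbit f x = (adjacent F)\<^sup>* `` {x}" for x using f(2) by (simp add: spans_def)
  \<comment> \<open>Every other edge at \<open>u\<close> or \<open>v\<close> is incident to
    \<open>{u, v}\<close>, so its color lies in \<open>S\<close> and the edge has been
    deleted.\<close>
  have F_uv: "e = {u, v}" if "e \<in> F" "u \<in> e \<or> v \<in> e" for e
    using that S by (auto simp: F_def incident_edges_def)
  have closed: "y \<in> {u, v}" if "(x, y) \<in> (adjacent F)\<^sup>*" "x \<in> {u, v}" for x y
    using that
  proof induction
    case (step y z)
    then have "{y, z} = {u, v}" by (intro F_uv) (auto simp: adjacent_def)
    then show ?case by auto
  qed
  have uvF: "{u, v} \<in> F" using uv S by (simp add: F_def)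
  have comp_u: "(adjacent F)\<^sup>* `` {u} = {u, v}"
    using closed[of u] uvF by (auto simp: adjacent_def)
  have comp_v: "(adjacent F)\<^sup>* `` {v} = {u, v}"
    using closed[of v] uvF by (auto simp: adjacent_def insert_commute)
  have fu: "f u = v"
  proof -
    have "f u \<in> {u, v}" using orbit.base[of f u] by (simp add: orb comp_u)
    moreover have "f u \<noteq> u" using orbit_eq_singleton_iff[of f u] ne by (auto simp: orb comp_u)
    ultimately show ?thesis by simp
  qed
  have fv: "f v = u"
  proof -
    have "f v \<in> {u, v}" using orbit.base[of f v] by (simp add: orb comp_v)
    moreover have "f v \<noteq> v" using orbit_eq_singleton_iff[of f v] ne by (auto simp: orb comp_v)
    ultimately show ?thesis by simp
  qed
  \<comment> \<open>\<open>{u, v}\<close> is already the one component of even order.\<close>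
  have odd_comp: "odd (card ((adjacent F)\<^sup>* `` {x}))" if "x \<in> V" "x \<notin> {u, v}" for x
  proof
    assume "even (card ((adjacent F)\<^sup>* `` {x}))"
    then have "(adjacent F)\<^sup>* `` {x} \<in> {C \<in> components V F. even (card C)}"
      using component_of(1)[OF that(1) FE] by simp
    moreover have "{u, v} \<in> {C \<in> components V F. even (card C)}"
      using component_of(1)[OF V(1) FE] ne by (simp add: comp_u)
    ultimately have "(adjacent F)\<^sup>* `` {x} = {u, v}"
      using card1 unfolding F_def[symmetric] by (metis (no_types, lifting) card_1_singletonE singletonD)
    then show False using that by blast
  qed
  \<comment> \<open>An odd exponent that is a multiple of every odd component size.\<close>
  define N where "N = \<Prod>{m. odd m \<and> m \<le> card V}"
  have fin: "finite {m. odd m \<and> m \<le> card V}" by simp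
  have "odd N" unfolding N_def using fin by (auto simp: even_prod_iff)
  have powN: "(f ^^ N) x = transpose u v x" for x
  proof -
    consider "x \<in> {u, v}" | "x \<notin> V" | "x \<in> V" "x \<notin> {u, v}" by blast
    then show ?thesis
    proof cases
      case 1
      \<comment> \<open>The square of \<open>f\<close> fixes \<open>u\<close> and \<open>v\<close>,
        so the odd power acts on them like \<open>f\<close> itself.\<close>
      obtain n where N: "N = Suc (2 * n)" using \<open>odd N\<close> by (auto elim: oddE)
      have "(f ^^ 2) x = x" using 1 fu fv by (auto simp: numeral_2_eq_2)
      then have "(f ^^ (2 * n)) x = x" by (rule funpow_dvd_fixpoint) simp
      then show ?thesis using 1 fu fv by (auto simp: N)
    next
      case 2
      then have "f x = x" using fV by (simp add: permutes_def)
      then have "(f ^^ N) x = x" by (induction N) simp_all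
      then show ?thesis using 2 V by (auto simp: transpose_def)
    next
      case 3
      have "card ((adjacent F)\<^sup>* `` {x}) \<le> card V"
        using component_of(2)[OF 3(1) FE] graph by (auto simp: finite_simple_graph_def card_mono)
      then have "card ((adjacent F)\<^sup>* `` {x}) dvd N"
        unfolding N_def using odd_comp[OF 3] fin by (intro dvd_prodI[where f = "\<lambda>m. m"]) auto
      then have "(f ^^ N) x = x" using funpow_dvd_fixpoint spans_funpow_card[OF f(2)] by metis
      then show ?thesis using 3 by simp
    qed
  qed
  then have "f ^^ N = transpose u v" by (simp add: fun_eq_iff)
  then show ?thesis using funpow_in_coloring_perms[OF f(1), of N] by simp
qed

section \<open>From one transposition to the symmetric group\<close>

text \<open>If both ends moved without being swapped, each would lie on an edge of color
  \<open>a\<close> other than \<open>{u, v}\<close>. Both edges are incident to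
  \<open>{u, v}\<close>, so by injectivity they coincide; but an edge containing \<open>u\<close>
  and \<open>v\<close> is \<open>{u, v}\<close>.\<close>

lemma color_perm_on_edge_ends:
  assumes "{u, v} \<in> E" "inj_on \<kappa> (incident_edges E {u, v})"
  shows "color_perm E \<kappa> a u = u \<or> color_perm E \<kappa> a v = v \<or> color_perm E \<kappa> a u = v"
proof (rule ccontr)
  assume neg: "\<not> ?thesis"
  obtain d e where d: "d \<in> E" "\<kappa> d = a" "u \<in> d" and e: "e \<in> E" "\<kappa> e = a" "v \<in> e"
    using neg color_perm_apply(2)[OF graph coloring] by blast
  have "{u, v} \<noteq> d" "{u, v} \<noteq> e"
    using neg color_perm_apply(1)[OF graph coloring assms(1)] d e by auto
  then have "d = e" using assms(2) d e by (auto simp: inj_on_def incident_edges_def)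
  moreover have "card d = 2" "card {u, v} = 2" "finite d"
    using graph assms(1) d finite_subset by (auto simp: finite_simple_graph_def)
  ultimately have "d = {u, v}"
    using card_subset_eq[of d "{u, v}"] d e by auto
  with \<open>{u, v} \<noteq> d\<close> show False by simp
qed

lemma coloring_group_eq_symmetric_group:
  assumes "connected_graph V E" and uv: "{u, v} \<in> E"
    and inj: "inj_on \<kappa> (incident_edges E {u, v})"
    and t: "transpose u v \<in> coloring_perms V E k \<kappa>"
  shows "coloring_group V E k \<kappa> = carrier (BijGroup V)"
proof
  let ?P = "coloring_perms V E k \<kappa>"
  have uV: "u \<in> V" using uv graph by (auto simp: finite_simple_graph_def)
  have closed: "transpose u (color_perm E \<kappa> a x) \<in> ?P"
    if x: "transpose u x \<in> ?P" and a: "a \<in> {1..k}" for a x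
  proof -
    let ?t = "color_perm E \<kappa> a"
    have u: "transpose (?t u) (?t x) \<in> ?P"
      by (rule transpose_color_perm_in_coloring_perms[OF a x])
    consider "?t u = u" | "?t u = v" | "?t v = v"
      using color_perm_on_edge_ends[OF uv inj] by blast
    then show ?thesis
    proof cases
      case 1
      then show ?thesis using u by simp
    next
      case 2
      \<comment> \<open>Here the conjugate is \<open>(v, ?t x)\<close>, which \<open>(u v)\<close>
        links to \<open>u\<close>.\<close>
      then show ?thesis using u t transpose_trans_in_coloring_perms by metis
    next
      case 3
      \<comment> \<open>Since \<open>?t\<close> fixes \<open>v\<close> here, \<open>v\<close> takes
        the place of \<open>u\<close> during the conjugation.\<close>
      have "transpose v x \<in> ?P"
        using t x transpose_trans_in_coloring_perms by (metis transpose_commute)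
      then have "transpose v (?t x) \<in> ?P"
        using transpose_color_perm_in_coloring_perms[OF a] 3 by metis
      then show ?thesis using t transpose_trans_in_coloring_perms by metis
    qed
  qed
  have star: "transpose u x \<in> ?P" if "(u, x) \<in> (adjacent E)\<^sup>*" for x
    using that
  proof induction
    case base
    show ?case using id_in_coloring_perms by (simp add: id_def)
  next
    case (step y z)
    then have yz: "{y, z} \<in> E" by (simp add: adjacent_def)
    then have "\<kappa> {y, z} \<in> {1..k}" using coloring by (auto simp: proper_edge_coloring_def)
    \<comment> \<open>The class of \<open>u\<close> is extended along an edge by the permutation of
      that edge's own color.\<close>
    moreover have "color_perm E \<kappa> (\<kappa> {y, z}) y = z"
      using color_perm_apply(1)[OF graph coloring yz] by simp
    ultimately show ?case using closed[OF step.IH] by metis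
  qed
  have swap: "transpose x y \<in> ?P" if "x \<in> V" "y \<in> V" for x y
    using that star uV assms(1) transpose_trans_in_coloring_perms
    unfolding connected_graph_def by (metis transpose_commute)
  have all: "g \<in> ?P" if "g permutes V" for g
  proof -
    have "finite V" using graph by (simp add: finite_simple_graph_def)
    with that show ?thesis
      by (induction rule: permutes_induct)
        (blast intro: id_in_coloring_perms comp_in_coloring_perms swap)+
  qed
  show "carrier (BijGroup V) \<subseteq> coloring_group V E k \<kappa>"
  proof
    fix h assume "h \<in> carrier (BijGroup V)"
    then have h: "h \<in> extensional V" "bij_betw h V V" by (auto simp: BijGroup_def Bij_def)
    \<comment> \<open>Elements of \<open>BijGroup V\<close> are undefined outside \<open>V\<close>;
      extending \<open>h\<close> by the identity makes it a permutation in the sense of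
      \<open>permutes\<close>.\<close>
    let ?g = "\<lambda>x. if x \<in> V then h x else x"
    have "bij_betw ?g V V"
      using h(2) by (simp cong: bij_betw_cong)
    then have "?g permutes V" by (rule bij_imp_permutes) simp
    then have "restrict ?g V \<in> coloring_group V E k \<kappa>"
      using all by (simp add: coloring_perms_def)
    moreover have "restrict ?g V = h" using h(1) by (auto simp: restrict_def extensional_def)
    ultimately show "h \<in> coloring_group V E k \<kappa>" by simp
  qed
  show "coloring_group V E k \<kappa> \<subseteq> carrier (BijGroup V)"
    unfolding coloring_group_def
    using color_perm_in_BijGroup[OF graph coloring]
    by (intro group.generate_incl[OF group_BijGroup]) auto
qed

end

theorem theorem3p15:
  fixes V :: "'a set" and E :: "'a set set" and k :: nat and \<kappa> :: "'a set \<Rightarrow> nat"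
  assumes "finite_tree V E"
    and "proper_edge_coloring E k \<kappa>"
    and "\<exists>e. symmetric_edge V E k \<kappa> e"
  shows "coloring_group V E k \<kappa> = carrier (BijGroup V)"
proof -
  have graph: "finite_simple_graph V E" and conn: "connected_graph V E"
    and acyclic: "\<not> (\<exists>p. is_cycle E p)"
    using assms(1) by (auto simp: finite_tree_def)
  obtain e where e: "symmetric_edge V E k \<kappa> e" using assms(3) ..
  then have "e \<in> E" by (simp add: symmetric_edge_def)
  then obtain u v where uv: "e = {u, v}"
    using graph by (auto simp: finite_simple_graph_def card_2_iff)
  show ?thesis
  proof (rule coloring_group_eq_symmetric_group[OF graph assms(2) conn])
    show "{u, v} \<in> E" using \<open>e \<in> E\<close> uv by simp
    show "inj_on \<kappa> (incident_edges E {u, v})" using e uv by (simp add: symmetric_edge_def)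
    show "transpose u v \<in> coloring_perms V E k \<kappa>"
      using symmetric_edge_transpose_in_coloring_perms[OF graph assms(2) acyclic] e uv by simp
  qed
qed

end
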